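(* For $A,B,X\in\mathbb{C}^{n\times n}$, $$\sigma(AX-XB)\prec_w 2\,\delta(A,B)\,\sigma(X).$$
   Context: $\sigma(X)=(\sigma_1(X),\dots,\sigma_n(X))$ is the vector of singular values of $X$ in decreasing order, $\|X\|_{(k)}=\sum_{i=1}^k\sigma_i(X)$ is the $k$-th Ky-Fan norm, $I_n$ is the identity, and products of vectors are entrywise. For $x,y\in\mathbb{R}^n$, $x\prec_w y$ (weak majorization) means $\sum_{i=1}^k x_i^{\downarrow}\le\sum_{i=1}^k y_i^{\downarrow}$ for $k=1,\dots,n$, where $x^{\downarrow}$ is the nonincreasing rearrangement of $x$. For $A,B\in\mathbb{C}^{n\times n}$ the vector $\delta(A,B)=(\delta_1(A,B),\dots,\delta_n(A,B))$ is defined by $$\sum_{i=1}^k\delta_i(A,B)=\min_{\alpha\in\mathbb{C}}\frac{\|A-\alpha I_n\|_{(k)}+\|B-\alpha I_n\|_{(k)}}{2},\qquad k=1,\dots,n.$$ *)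

theory Defs
  imports "Jordan_Normal_Form.Schur_Decomposition"
begin

text \<open>Vectors and matrices are those of the AFP entry on Jordan normal forms, where indices start
  at 0: the entry with mathematical index \<open>i\<close> is \<open>x $ (i - 1)\<close>, and
  \<open>\<Sum>i<k. x $ i\<close> is the sum of the first \<open>k\<close> entries.\<close>

text \<open>The singular values of \<open>X\<close> are the square roots of the eigenvalues of \<open>X\<^sup>* X\<close>, counted with
  algebraic multiplicity. These eigenvalues are real and nonnegative, so \<open>Re\<close> is only
  the coercion from the complex numbers to the reals.\<close>

definition singular_values :: "complex mat \<Rightarrow> real vec" where
  "singular_values X = vec_of_list (rev (sorted_list_of_multiset
     (image_mset (\<lambda>z. sqrt (Re z)) (proots (char_poly (mat_adjoint X * X))))))"

definition ky_fan_norm :: "nat \<Rightarrow> complex mat \<Rightarrow> real" where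
  "ky_fan_norm k X = (\<Sum>i<k. singular_values X $ i)"

definition decreasing_rearrangement :: "real vec \<Rightarrow> real vec" where
  "decreasing_rearrangement x = vec_of_list (rev (sort (list_of_vec x)))"

definition weakly_majorized :: "real vec \<Rightarrow> real vec \<Rightarrow> bool"  (infix \<open>\<prec>\<^sub>w\<close> 50) where
  "x \<prec>\<^sub>w y \<longleftrightarrow> dim_vec x = dim_vec y \<and>
     (\<forall>k\<in>{1..dim_vec x}. (\<Sum>i<k. decreasing_rearrangement x $ i)
                        \<le> (\<Sum>i<k. decreasing_rearrangement y $ i))"

definition entrywise_prod :: "real vec \<Rightarrow> real vec \<Rightarrow> real vec"  (infixl \<open>\<odot>\<^sub>v\<close> 70) where
  "x \<odot>\<^sub>v y = vec (dim_vec x) (\<lambda>i. x $ i * y $ i)"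

text \<open>\<open>LEAST\<close> is the minimum over all complex \<open>\<alpha>\<close>; it is attained because, for \<open>1 \<le> k \<le> n\<close>,
  the expression is continuous in \<open>\<alpha>\<close> and tends to infinity with \<open>\<bar>\<alpha>\<bar>\<close>.\<close>

definition delta_sum :: "nat \<Rightarrow> complex mat \<Rightarrow> complex mat \<Rightarrow> real" where
  "delta_sum k A B = (LEAST r. r \<in> range (\<lambda>\<alpha>::complex.
     (ky_fan_norm k (A - \<alpha> \<cdot>\<^sub>m 1\<^sub>m (dim_row A)) + ky_fan_norm k (B - \<alpha> \<cdot>\<^sub>m 1\<^sub>m (dim_row B))) / 2))"

text \<open>The vector \<open>\<delta>(A,B)\<close> is determined by its partial sums, so its entries are their
  successive differences; see \<open>sum_delta_vec\<close> below.\<close>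

definition delta_vec :: "complex mat \<Rightarrow> complex mat \<Rightarrow> real vec" where
  "delta_vec A B = vec (dim_row A) (\<lambda>i. delta_sum (Suc i) A B - delta_sum i A B)"

lemma delta_sum_0: "delta_sum 0 A B = 0"
  by (simp add: delta_sum_def ky_fan_norm_def Least_equality)

lemma sum_delta_vec:
  assumes "A \<in> carrier_mat n n" and "k \<le> n"
  shows "(\<Sum>i<k. delta_vec A B $ i) = delta_sum k A B"
proof -
  have "(\<Sum>i<k. delta_vec A B $ i) = (\<Sum>i<k. delta_sum (Suc i) A B - delta_sum i A B)"
    using assms by (intro sum.cong) (auto simp: delta_vec_def)
  also have "\<dots> = delta_sum k A B"
    by (subst sum_lessThan_telescope) (simp add: delta_sum_0)
  finally show ?thesis .
qed

lemma dim_singular_values: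
  assumes X: "X \<in> carrier_mat n n"
  shows "dim_vec (singular_values X) = n"
proof -
  have "mat_adjoint X * X \<in> carrier_mat n n"
    using X by (auto simp: mat_adjoint_def)
  then have "size (proots (char_poly (mat_adjoint X * X))) = n"
    by (simp add: size_proots_complex degree_monic_char_poly)
  then show ?thesis
    by (metis singular_values_def dim_vec_of_list length_rev mset_sorted_list_of_multiset
        size_image_mset size_mset)
qed

end

theory Submission
  imports Defs "HOL-Analysis.Elementary_Topology"
begin

text \<open>By Ky Fan's variational principle, \<open>\<parallel>A X - X B\<parallel>\<^bsub>(k)\<^esub> = Re tr ((A X - X B) W)\<close> for
  some \<open>W\<close> of rank at most \<open>k\<close> and norm at most 1. If \<open>X = U \<Sigma> V\<close> is a singular value
  decomposition and \<open>P\<^sub>j\<close> is \<open>U V\<close> with only the first \<open>j\<close> singular directions kept, then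
  \<open>X = \<Sum>j. (\<sigma>\<^sub>j - \<sigma>\<^sub>j\<^sub>+\<^sub>1) P\<^sub>j\<close>. Since \<open>P\<^sub>j W\<close> and \<open>W P\<^sub>j\<close> have rank at most \<open>min j k\<close> and
  the same trace, \<open>Re tr ((A P\<^sub>j - P\<^sub>j B) W)\<close> does not change when \<open>\<alpha>\<close> is subtracted from both
  \<open>A\<close> and \<open>B\<close>, and it is at most \<open>\<parallel>A - \<alpha>\<parallel> + \<parallel>B - \<alpha>\<parallel>\<close> in the Ky Fan norm of index
  \<open>min j k\<close>. The shift \<open>\<alpha>\<close> may depend on \<open>j\<close>; minimizing over it for each \<open>j\<close> and summing
  by parts gives the claim.\<close>

section \<open>Adjoints, diagonal matrices and traces\<close>

lemma index_mat_adjoint [simp]: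
  fixes A :: "complex mat"
  assumes "i < dim_col A" "j < dim_row A"
  shows "mat_adjoint A $$ (i, j) = cnj (A $$ (j, i))"
  using assms by (simp add: mat_adjoint_def mat_of_rows_def)

lemma dim_mat_adjoint [simp]:
  "dim_row (mat_adjoint A) = dim_col A" "dim_col (mat_adjoint A) = dim_row A"
  by (simp_all add: mat_adjoint_def)

lemma mat_adjoint_carrier [simp]:
  "A \<in> carrier_mat m n \<Longrightarrow> mat_adjoint A \<in> carrier_mat n m"
  by (metis carrier_matD carrier_matI dim_mat_adjoint)

lemma index_mult_mat_sum:
  assumes "A \<in> carrier_mat m n" "B \<in> carrier_mat n p" "i < m" "j < p"
  shows "(A * B) $$ (i, j) = (\<Sum>l<n. A $$ (i, l) * B $$ (l, j))"
  using assms by (auto simp: scalar_prod_def lessThan_atLeast0 intro!: sum.cong)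

lemma mat_adjoint_adjoint [simp]: "mat_adjoint (mat_adjoint A) = (A :: complex mat)"
  by (intro eq_matI) auto

lemma mat_adjoint_mult:
  fixes A B :: "complex mat"
  assumes "A \<in> carrier_mat m n" "B \<in> carrier_mat n p"
  shows "mat_adjoint (A * B) = mat_adjoint B * mat_adjoint A"
proof (rule eq_matI)
  fix i j assume "i < dim_row (mat_adjoint B * mat_adjoint A)"
    and "j < dim_col (mat_adjoint B * mat_adjoint A)"
  then have ij: "i < p" "j < m" using assms by auto
  then have "mat_adjoint (A * B) $$ (i, j) = cnj ((A * B) $$ (j, i))"
    using assms by (intro index_mat_adjoint) auto
  also have "\<dots> = (\<Sum>l<n. mat_adjoint B $$ (i, l) * mat_adjoint A $$ (l, j))"
    unfolding index_mult_mat_sum[OF assms ij(2,1)] using assms ij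
    by (auto intro!: sum.cong)
  also have "\<dots> = (mat_adjoint B * mat_adjoint A) $$ (i, j)"
    using assms ij by (intro index_mult_mat_sum[symmetric]) auto
  finally show "mat_adjoint (A * B) $$ (i, j) = (mat_adjoint B * mat_adjoint A) $$ (i, j)" .
qed (use assms in auto)

definition diag :: "nat \<Rightarrow> (nat \<Rightarrow> complex) \<Rightarrow> complex mat" where
  "diag n f = mat n n (\<lambda>(i, j). if i = j then f i else 0)"

lemma diag_carrier [simp]: "diag n f \<in> carrier_mat n n"
  by (simp add: diag_def)

lemma dim_diag [simp]: "dim_row (diag n f) = n" "dim_col (diag n f) = n"
  by (simp_all add: diag_def)

lemma index_diag [simp]: "i < n \<Longrightarrow> j < n \<Longrightarrow> diag n f $$ (i, j) = (if i = j then f i else 0)"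
  by (simp add: diag_def)

lemma index_diag_mult:
  assumes "A \<in> carrier_mat n p" "i < n" "j < p"
  shows "(diag n f * A) $$ (i, j) = f i * A $$ (i, j)"
proof -
  have "(diag n f * A) $$ (i, j) = (\<Sum>l<n. diag n f $$ (i, l) * A $$ (l, j))"
    using assms by (intro index_mult_mat_sum) auto
  also have "\<dots> = (\<Sum>l<n. if l = i then f i * A $$ (i, j) else 0)"
    using assms by (intro sum.cong) auto
  finally show ?thesis using assms by simp
qed

lemma index_mult_diag:
  assumes "A \<in> carrier_mat p n" "i < p" "j < n"
  shows "(A * diag n f) $$ (i, j) = A $$ (i, j) * f j"
proof -
  have "(A * diag n f) $$ (i, j) = (\<Sum>l<n. A $$ (i, l) * diag n f $$ (l, j))"
    using assms by (intro index_mult_mat_sum) auto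
  also have "\<dots> = (\<Sum>l<n. if l = j then A $$ (i, j) * f j else 0)"
    using assms by (intro sum.cong) auto
  finally show ?thesis using assms by simp
qed

lemma diag_mult_diag: "diag n f * diag n g = diag n (\<lambda>i. f i * g i)"
  by (rule eq_matI) (auto simp: index_diag_mult[OF diag_carrier] simp del: index_mult_mat(1))

lemma mat_adjoint_diag: "mat_adjoint (diag n f) = diag n (\<lambda>i. cnj (f i))"
  by (rule eq_matI) auto

lemma diag_one: "diag n (\<lambda>_. 1) = 1\<^sub>m n"
  by (rule eq_matI) auto

lemma diag_cong: "(\<And>i. i < n \<Longrightarrow> f i = g i) \<Longrightarrow> diag n f = diag n g"
  by (rule eq_matI) auto

lemma square_mult_carrier [simp]:
  "A \<in> carrier_mat n n \<Longrightarrow> B \<in> carrier_mat n n \<Longrightarrow> A * B \<in> carrier_mat n n"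
  by (rule mult_carrier_mat)

lemma square_mult_assoc:
  "A \<in> carrier_mat n n \<Longrightarrow> B \<in> carrier_mat n n \<Longrightarrow> C \<in> carrier_mat n n
    \<Longrightarrow> (A * B) * C = A * (B * C)"
  by (rule assoc_mult_mat)

definition trace :: "complex mat \<Rightarrow> complex" where
  "trace A = (\<Sum>i<dim_row A. A $$ (i, i))"

lemma trace_comm:
  assumes "A \<in> carrier_mat m n" "B \<in> carrier_mat n m"
  shows "trace (A * B) = trace (B * A)"
proof -
  have "trace (A * B) = (\<Sum>i<m. \<Sum>j<n. A $$ (i, j) * B $$ (j, i))"
    unfolding trace_def using assms by (intro sum.cong index_mult_mat_sum) auto
  also have "\<dots> = (\<Sum>j<n. \<Sum>i<m. B $$ (j, i) * A $$ (i, j))"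
    by (subst sum.swap) (simp add: mult.commute)
  also have "\<dots> = trace (B * A)"
    unfolding trace_def using assms by (intro sum.cong index_mult_mat_sum[symmetric]) auto
  finally show ?thesis .
qed

lemma trace_minus:
  "A \<in> carrier_mat n n \<Longrightarrow> B \<in> carrier_mat n n \<Longrightarrow> trace (A - B) = trace A - trace B"
  unfolding trace_def by (subst sum.cong[OF refl, of _ _ "\<lambda>i. A $$ (i, i) - B $$ (i, i)"])
    (auto simp: sum_subtractf)

lemma trace_smult: "A \<in> carrier_mat n n \<Longrightarrow> trace (c \<cdot>\<^sub>m A) = c * trace A"
  unfolding trace_def sum_distrib_left by (intro sum.cong) auto

section \<open>Contractions\<close>

definition sq_length :: "complex vec \<Rightarrow> real" where
  "sq_length v = (\<Sum>i<dim_vec v. (cmod (v $ i))\<^sup>2)"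

lemma sq_length_nonneg [simp]: "0 \<le> sq_length v"
  by (simp add: sq_length_def sum_nonneg)

lemma cscalar_prod_self: "v \<bullet>c v = complex_of_real (sq_length v)"
  by (simp add: scalar_prod_def sq_length_def lessThan_atLeast0 complex_norm_square
      del: of_real_power)

lemma cscalar_prod_mult_mat_vec:
  fixes A :: "complex mat"
  assumes "A \<in> carrier_mat m n" "v \<in> carrier_vec n" "w \<in> carrier_vec m"
  shows "(A *\<^sub>v v) \<bullet>c w = v \<bullet>c (mat_adjoint A *\<^sub>v w)"
proof -
  have "(A *\<^sub>v v) \<bullet>c w = (\<Sum>i<m. (\<Sum>j<n. A $$ (i, j) * v $ j) * cnj (w $ i))"
    using assms by (auto simp: scalar_prod_def lessThan_atLeast0 intro!: sum.cong)
  also have "\<dots> = (\<Sum>j<n. \<Sum>i<m. A $$ (i, j) * v $ j * cnj (w $ i))"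
    by (subst sum.swap) (simp add: sum_distrib_right)
  also have "\<dots> = (\<Sum>j<n. v $ j * cnj (\<Sum>i<m. mat_adjoint A $$ (j, i) * w $ i))"
    using assms by (auto simp: sum_distrib_left mult_ac intro!: sum.cong)
  also have "\<dots> = v \<bullet>c (mat_adjoint A *\<^sub>v w)"
    using assms by (auto simp: scalar_prod_def lessThan_atLeast0 intro!: sum.cong)
  finally show ?thesis .
qed

lemma sq_length_minus:
  assumes "v \<in> carrier_vec n" "w \<in> carrier_vec n"
  shows "sq_length (v - w) = sq_length v - 2 * Re (v \<bullet>c w) + sq_length w"
proof -
  have "(cmod (v $ i - w $ i))\<^sup>2
      = (cmod (v $ i))\<^sup>2 - 2 * Re (v $ i * cnj (w $ i)) + (cmod (w $ i))\<^sup>2" for i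
    unfolding cmod_power2 by (simp add: power2_eq_square algebra_simps)
  then have "sq_length (v - w)
      = (\<Sum>i<n. (cmod (v $ i))\<^sup>2 - 2 * Re (v $ i * cnj (w $ i)) + (cmod (w $ i))\<^sup>2)"
    using assms unfolding sq_length_def by (intro sum.cong) auto
  also have "\<dots> = (\<Sum>i<n. (cmod (v $ i))\<^sup>2) - 2 * Re (\<Sum>i<n. v $ i * cnj (w $ i))
      + (\<Sum>i<n. (cmod (w $ i))\<^sup>2)"
    by (simp only: sum.distrib sum_subtractf sum_distrib_left Re_sum)
  also have "(\<Sum>i<n. v $ i * cnj (w $ i)) = v \<bullet>c w"
    using assms by (auto simp: scalar_prod_def lessThan_atLeast0)
  finally show ?thesis using assms by (simp add: sq_length_def)
qed

definition contraction :: "nat \<Rightarrow> complex mat \<Rightarrow> bool" where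
  "contraction n A \<longleftrightarrow> A \<in> carrier_mat n n \<and>
     (\<forall>v \<in> carrier_vec n. sq_length (A *\<^sub>v v) \<le> sq_length v)"

lemma contraction_carrier: "contraction n A \<Longrightarrow> A \<in> carrier_mat n n"
  by (simp add: contraction_def)

lemma contraction_mult:
  assumes "contraction n A" "contraction n B"
  shows "contraction n (A * B)"
  unfolding contraction_def
proof (intro conjI ballI)
  have AB: "A \<in> carrier_mat n n" "B \<in> carrier_mat n n"
    using assms by (simp_all add: contraction_def)
  then show "A * B \<in> carrier_mat n n" by simp
  fix v :: "complex vec" assume v: "v \<in> carrier_vec n"
  have "sq_length (A *\<^sub>v (B *\<^sub>v v)) \<le> sq_length (B *\<^sub>v v)"
    using assms AB v by (simp add: contraction_def)
  also have "\<dots> \<le> sq_length v"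
    using assms v by (simp add: contraction_def)
  finally show "sq_length (A * B *\<^sub>v v) \<le> sq_length v"
    using AB v by simp
qed

lemma contraction_smult:
  assumes A: "contraction n A" and c: "cmod c \<le> 1"
  shows "contraction n (c \<cdot>\<^sub>m A)"
  unfolding contraction_def
proof (intro conjI ballI)
  show "c \<cdot>\<^sub>m A \<in> carrier_mat n n" using A by (simp add: contraction_def)
  fix v :: "complex vec" assume v: "v \<in> carrier_vec n"
  have "c \<cdot>\<^sub>m A *\<^sub>v v = c \<cdot>\<^sub>v (A *\<^sub>v v)"
    using A v by (intro eq_vecI) (auto simp: contraction_def)
  then have "sq_length (c \<cdot>\<^sub>m A *\<^sub>v v) = (cmod c)\<^sup>2 * sq_length (A *\<^sub>v v)"
    by (simp add: sq_length_def norm_mult power_mult_distrib sum_distrib_left)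
  also have "\<dots> \<le> 1 * sq_length (A *\<^sub>v v)"
    using c by (intro mult_right_mono) (auto simp: abs_square_le_1)
  also have "\<dots> \<le> sq_length v"
    using A v by (simp add: contraction_def)
  finally show "sq_length (c \<cdot>\<^sub>m A *\<^sub>v v) \<le> sq_length v" .
qed

lemma contraction_adjoint:
  assumes A: "contraction n A"
  shows "contraction n (mat_adjoint A)"
  unfolding contraction_def
proof (intro conjI ballI)
  have [simp]: "A \<in> carrier_mat n n" using A by (simp add: contraction_def)
  show "mat_adjoint A \<in> carrier_mat n n" by simp
  fix v :: "complex vec" assume v [simp]: "v \<in> carrier_vec n"
  define w where "w = mat_adjoint A *\<^sub>v v"
  have w [simp]: "w \<in> carrier_vec n"
    unfolding w_def by (rule mult_mat_vec_carrier[of _ n n]) auto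
  have "w \<bullet>c w = (mat_adjoint A *\<^sub>v v) \<bullet>c w" by (simp add: w_def)
  also have "\<dots> = v \<bullet>c (A *\<^sub>v w)"
    by (subst cscalar_prod_mult_mat_vec[of _ n n]) auto
  finally have "complex_of_real (sq_length w) = v \<bullet>c (A *\<^sub>v w)"
    by (simp only: cscalar_prod_self)
  then have "Re (v \<bullet>c (A *\<^sub>v w)) = sq_length w"
    by (simp only: Re_complex_of_real flip: \<open>complex_of_real (sq_length w) = _\<close>)
  then have "sq_length (v - A *\<^sub>v w) = sq_length v - 2 * sq_length w + sq_length (A *\<^sub>v w)"
    by (subst sq_length_minus[of _ n]) (auto intro!: mult_mat_vec_carrier[of _ n n])
  moreover have "sq_length (A *\<^sub>v w) \<le> sq_length w"
    using A by (simp add: contraction_def)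
  ultimately show "sq_length (mat_adjoint A *\<^sub>v v) \<le> sq_length v"
    using sq_length_nonneg[of "v - A *\<^sub>v w"] by (simp add: w_def)
qed

lemma contraction_if_gram_diag:
  assumes A: "A \<in> carrier_mat n n"
    and gram: "mat_adjoint A * A = diag n (\<lambda>i. complex_of_real (e i))"
    and e: "\<And>i. i < n \<Longrightarrow> e i \<le> 1"
  shows "contraction n A"
  unfolding contraction_def
proof (intro conjI ballI)
  fix v :: "complex vec" assume v: "v \<in> carrier_vec n"
  have "(A *\<^sub>v v) \<bullet>c (A *\<^sub>v v) = v \<bullet>c (mat_adjoint A *\<^sub>v (A *\<^sub>v v))"
    using A v by (intro cscalar_prod_mult_mat_vec) (auto intro!: mult_mat_vec_carrier)
  also have "mat_adjoint A *\<^sub>v (A *\<^sub>v v) = diag n (\<lambda>i. complex_of_real (e i)) *\<^sub>v v"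
    using A v by (subst assoc_mult_mat_vec[symmetric, of _ n n]) (auto simp: gram)
  also have "\<dots> = vec n (\<lambda>i. complex_of_real (e i) * v $ i)"
  proof (rule eq_vecI)
    fix i assume "i < dim_vec (vec n (\<lambda>i. complex_of_real (e i) * v $ i))"
    then have i: "i < n" by simp
    have "(diag n (\<lambda>i. complex_of_real (e i)) *\<^sub>v v) $ i
        = (\<Sum>j<n. diag n (\<lambda>i. complex_of_real (e i)) $$ (i, j) * v $ j)"
      using i v by (simp add: scalar_prod_def lessThan_atLeast0 del: index_diag)
    also have "\<dots> = (\<Sum>j<n. if j = i then complex_of_real (e i) * v $ i else 0)"
      using i by (intro sum.cong) auto
    finally show "(diag n (\<lambda>i. complex_of_real (e i)) *\<^sub>v v) $ i
        = vec n (\<lambda>i. complex_of_real (e i) * v $ i) $ i"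
      using i by simp
  qed simp
  also have "v \<bullet>c \<dots> = (\<Sum>i<n. complex_of_real (e i * (cmod (v $ i))\<^sup>2))"
    using v unfolding scalar_prod_def
    by (auto simp: lessThan_atLeast0 complex_norm_square simp del: of_real_power intro!: sum.cong)
  finally have "sq_length (A *\<^sub>v v) = (\<Sum>i<n. e i * (cmod (v $ i))\<^sup>2)"
    by (simp only: cscalar_prod_self of_real_sum[symmetric] of_real_eq_iff)
  also have "\<dots> \<le> (\<Sum>i<n. 1 * (cmod (v $ i))\<^sup>2)"
    using e by (intro sum_mono mult_right_mono) auto
  finally show "sq_length (A *\<^sub>v v) \<le> sq_length v"
    using v by (simp add: sq_length_def)
qed (fact A)

lemma contraction_diag:
  assumes "\<And>i. i < n \<Longrightarrow> cmod (f i) \<le> 1"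
  shows "contraction n (diag n f)"
proof (rule contraction_if_gram_diag)
  show "mat_adjoint (diag n f) * diag n f = diag n (\<lambda>i. complex_of_real ((cmod (f i))\<^sup>2))"
    by (simp only: mat_adjoint_diag diag_mult_diag complex_norm_square mult.commute)
qed (use assms in \<open>auto simp: abs_square_le_1\<close>)

lemma contraction_col:
  assumes A: "contraction n A" and j: "j < n"
  shows "(\<Sum>i<n. (cmod (A $$ (i, j)))\<^sup>2) \<le> 1"
proof -
  have carrier: "A \<in> carrier_mat n n" using A by (simp add: contraction_def)
  have "A *\<^sub>v unit_vec n j = col A j"
    using carrier j by (intro eq_vecI) auto
  moreover have "sq_length (A *\<^sub>v unit_vec n j) \<le> sq_length (unit_vec n j)"
    using A by (simp add: contraction_def)
  moreover have "sq_length (unit_vec n j) = (\<Sum>i<n. if i = j then 1 else 0)"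
    unfolding sq_length_def using j by (intro sum.cong) auto
  ultimately show ?thesis
    using carrier j by (simp add: sq_length_def)
qed

lemma contraction_row:
  assumes A: "contraction n A" and i: "i < n"
  shows "(\<Sum>j<n. (cmod (A $$ (i, j)))\<^sup>2) \<le> 1"
  using contraction_col[OF contraction_adjoint[OF A] i] i contraction_carrier[OF A] by simp

definition truncation :: "nat \<Rightarrow> nat \<Rightarrow> complex mat" where
  "truncation n r = diag n (\<lambda>i. if i < r then 1 else 0)"

lemma truncation_carrier [simp]: "truncation n r \<in> carrier_mat n n"
  by (simp add: truncation_def)

lemma contraction_truncation: "contraction n (truncation n r)"
  unfolding truncation_def by (rule contraction_diag) auto

definition truncated_contraction :: "nat \<Rightarrow> nat \<Rightarrow> complex mat \<Rightarrow> bool" where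
  "truncated_contraction n r Q \<longleftrightarrow>
     (\<exists>S T. contraction n S \<and> contraction n T \<and> Q = S * truncation n r * T)"

lemma truncated_contraction_carrier:
  "truncated_contraction n r Q \<Longrightarrow> Q \<in> carrier_mat n n"
  by (auto simp: truncated_contraction_def dest!: contraction_carrier)

lemma truncated_contraction_mult_left:
  assumes Q: "truncated_contraction n r Q" and R: "contraction n R"
  shows "truncated_contraction n r (R * Q)"
proof -
  obtain S T where S: "contraction n S" and T: "contraction n T" and "Q = S * truncation n r * T"
    using Q by (auto simp: truncated_contraction_def)
  moreover note this(1,2)[THEN contraction_carrier] contraction_carrier[OF R]
  ultimately have "R * Q = (R * S) * truncation n r * T"
    by (simp add: square_mult_assoc[where n = n])
  then show ?thesis
    using S T R contraction_mult unfolding truncated_contraction_def by blast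
qed

lemma truncated_contraction_mult_right:
  assumes Q: "truncated_contraction n r Q" and R: "contraction n R"
  shows "truncated_contraction n r (Q * R)"
proof -
  obtain S T where S: "contraction n S" and T: "contraction n T" and "Q = S * truncation n r * T"
    using Q by (auto simp: truncated_contraction_def)
  moreover note this(1,2)[THEN contraction_carrier] contraction_carrier[OF R]
  ultimately have "Q * R = S * truncation n r * (T * R)"
    by (simp add: square_mult_assoc[where n = n])
  then show ?thesis
    using S T R contraction_mult unfolding truncated_contraction_def by blast
qed

lemma truncated_contraction_smult:
  assumes Q: "truncated_contraction n r Q" and c: "cmod c \<le> 1"
  shows "truncated_contraction n r (c \<cdot>\<^sub>m Q)"
proof -
  obtain S T where S: "contraction n S" and T: "contraction n T" and Q: "Q = S * truncation n r * T"
    using Q by (auto simp: truncated_contraction_def)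
  have "c \<cdot>\<^sub>m Q = (c \<cdot>\<^sub>m S) * truncation n r * T"
    using S[THEN contraction_carrier] T[THEN contraction_carrier] unfolding Q
    by (simp add: mult_smult_assoc_mat[where nr = n and n = n and nc = n])
  then show ?thesis
    using contraction_smult[OF S c] T unfolding truncated_contraction_def by blast
qed

lemma truncated_contraction_diagonal:
  assumes Q: "truncated_contraction n r Q"
  shows "l < n \<Longrightarrow> cmod (Q $$ (l, l)) \<le> 1"
    and "(\<Sum>l<n. cmod (Q $$ (l, l))) \<le> real r"
proof -
  obtain S T where S: "contraction n S" and T: "contraction n T" and Q: "Q = S * truncation n r * T"
    using Q by (auto simp: truncated_contraction_def)
  note carrier = S[THEN contraction_carrier] T[THEN contraction_carrier]
  let ?J = "{m. m < n \<and> m < r}"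
  let ?h = "\<lambda>l m. ((cmod (S $$ (l, m)))\<^sup>2 + (cmod (T $$ (m, l)))\<^sup>2) / 2"
  have bound: "cmod (Q $$ (l, l)) \<le> (\<Sum>m\<in>?J. ?h l m)" if l: "l < n" for l
  proof -
    have "Q $$ (l, l) = (\<Sum>m<n. (S * truncation n r) $$ (l, m) * T $$ (m, l))"
      unfolding Q using carrier l by (intro index_mult_mat_sum) auto
    also have "\<dots> = (\<Sum>m<n. S $$ (l, m) * (if m < r then 1 else 0) * T $$ (m, l))"
      unfolding truncation_def using carrier l
      by (intro sum.cong refl) (simp add: index_mult_diag del: index_mult_mat(1))
    also have "\<dots> = (\<Sum>m\<in>?J. S $$ (l, m) * T $$ (m, l))"
      by (intro sum.mono_neutral_cong_right) auto
    also have "cmod \<dots> \<le> (\<Sum>m\<in>?J. cmod (S $$ (l, m)) * cmod (T $$ (m, l)))"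
      by (rule order_trans[OF norm_sum]) (simp add: norm_mult)
    also have "\<dots> \<le> (\<Sum>m\<in>?J. ?h l m)"
    proof (rule sum_mono)
      fix m
      show "cmod (S $$ (l, m)) * cmod (T $$ (m, l)) \<le> ?h l m"
        using sum_squares_bound[of "cmod (S $$ (l, m))" "cmod (T $$ (m, l))"] by simp
    qed
    finally show ?thesis .
  qed
  show "cmod (Q $$ (l, l)) \<le> 1" if l: "l < n"
  proof -
    have "cmod (Q $$ (l, l)) \<le> (\<Sum>m<n. ?h l m)"
      by (rule order_trans[OF bound[OF l]], rule sum_mono2) auto
    also have "\<dots> = ((\<Sum>m<n. (cmod (S $$ (l, m)))\<^sup>2) + (\<Sum>m<n. (cmod (T $$ (m, l)))\<^sup>2)) / 2"
      by (simp add: sum.distrib sum_divide_distrib[symmetric])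
    also have "\<dots> \<le> 1"
      using contraction_row[OF S l] contraction_col[OF T l] by simp
    finally show ?thesis .
  qed
  have "(\<Sum>l<n. cmod (Q $$ (l, l))) \<le> (\<Sum>l<n. \<Sum>m\<in>?J. ?h l m)"
    using bound by (intro sum_mono) auto
  also have "\<dots> = (\<Sum>m\<in>?J. \<Sum>l<n. ?h l m)"
    by (rule sum.swap)
  also have "\<dots> \<le> (\<Sum>m\<in>?J. 1)"
  proof (rule sum_mono)
    fix m assume "m \<in> ?J"
    then have m: "m < n" by simp
    have "(\<Sum>l<n. ?h l m)
        = ((\<Sum>l<n. (cmod (S $$ (l, m)))\<^sup>2) + (\<Sum>l<n. (cmod (T $$ (m, l)))\<^sup>2)) / 2"
      by (simp add: sum.distrib sum_divide_distrib[symmetric])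
    also have "\<dots> \<le> 1"
      using contraction_col[OF S m] contraction_row[OF T m] by simp
    finally show "(\<Sum>l<n. ?h l m) \<le> 1" .
  qed
  also have "\<dots> \<le> real r"
    using card_mono[of "{..<r}" ?J] by auto
  finally show "(\<Sum>l<n. cmod (Q $$ (l, l))) \<le> real r" .
qed

section \<open>Singular value decomposition\<close>

lemma unitary_completion:
  fixes v :: "complex vec"
  assumes v: "v \<in> carrier_vec n" and v0: "v \<noteq> 0\<^sub>v n"
  obtains W c where "W \<in> carrier_mat n n" "mat_adjoint W * W = 1\<^sub>m n" "col W 0 = c \<cdot>\<^sub>v v"
proof -
  interpret cof_vec_space n "TYPE(complex)" .
  define b where "b = basis_completion v"
  define ws where "ws = gram_schmidt n b"
  from basis_completion[OF v v0, folded b_def]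
  have b: "distinct b" "\<not> lin_dep (set b)" "set b \<subseteq> carrier_vec n" "hd b = v" "length b = n"
    by auto
  from gram_schmidt_result[OF b(3,1,2) refl, folded ws_def] b(5)
  have ws: "set ws \<subseteq> carrier_vec n" "corthogonal ws" "length ws = n"
    by auto
  have n0: "n \<noteq> 0"
    using v v0 by (intro notI) auto
  then obtain vs where "b = v # vs"
    using b(4,5) by (cases b) auto
  then have hd_ws: "hd ws = v"
    using gram_schmidt_hd[OF v, of vs] by (simp add: ws_def)
  define c where "c w = complex_of_real (1 / sqrt (sq_length w))" for w
  define W where "W = mat n n (\<lambda>(i, j). c (ws ! j) * ws ! j $ i)"
  have W: "W \<in> carrier_mat n n" by (simp add: W_def)
  have ws_carrier: "ws ! i \<in> carrier_vec n" if "i < n" for i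
    using ws that by (auto simp: subset_iff)
  have "mat_adjoint W * W = 1\<^sub>m n"
  proof (rule eq_matI)
    fix i j assume "i < dim_row (1\<^sub>m n)" "j < dim_col (1\<^sub>m n)"
    then have ij: "i < n" "j < n" by auto
    have "(mat_adjoint W * W) $$ (i, j) = (\<Sum>l<n. mat_adjoint W $$ (i, l) * W $$ (l, j))"
      using W ij by (intro index_mult_mat_sum) auto
    also have "\<dots> = (\<Sum>l<n. cnj (c (ws ! i)) * c (ws ! j) * (ws ! j $ l * cnj (ws ! i $ l)))"
      using W ij by (intro sum.cong) (auto simp: W_def)
    also have "\<dots> = cnj (c (ws ! i)) * c (ws ! j) * (ws ! j \<bullet>c ws ! i)"
      using ws_carrier[OF ij(1)] ws_carrier[OF ij(2)] unfolding sum_distrib_left[symmetric]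
      by (simp add: scalar_prod_def lessThan_atLeast0)
    also have "\<dots> = (if i = j then 1 else 0)"
    proof (cases "i = j")
      case True
      have "ws ! j \<bullet>c ws ! j \<noteq> 0"
        using corthogonalD[OF ws(2), of j j] ws(3) ij by simp
      then have "sq_length (ws ! j) \<noteq> 0"
        by (simp only: cscalar_prod_self of_real_eq_0_iff not_False_eq_True)
      then have "sq_length (ws ! j) > 0"
        using sq_length_nonneg[of "ws ! j"] by linarith
      then have "1 / sqrt (sq_length (ws ! j)) * (1 / sqrt (sq_length (ws ! j)))
          * sq_length (ws ! j) = 1"
        by simp
      then show ?thesis
        unfolding True c_def cscalar_prod_self complex_cnj_complex_of_real of_real_mult[symmetric]
        by simp
    next
      case False
      then show ?thesis
        using corthogonalD[OF ws(2), of j i] ws(3) ij by simp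
    qed
    finally show "(mat_adjoint W * W) $$ (i, j) = 1\<^sub>m n $$ (i, j)"
      using ij by simp
  qed (use W in auto)
  moreover have "col W 0 = c v \<cdot>\<^sub>v v"
  proof -
    have "ws ! 0 = v" using n0 hd_ws ws(3) hd_conv_nth[of ws] by force
    then show ?thesis using n0 v by (intro eq_vecI) (auto simp: W_def)
  qed
  ultimately show ?thesis using W that by blast
qed

lemma mat_adjoint_four_block:
  fixes A B C D :: "complex mat"
  assumes "A \<in> carrier_mat m m" "B \<in> carrier_mat m n" "C \<in> carrier_mat n m" "D \<in> carrier_mat n n"
  shows "mat_adjoint (four_block_mat A B C D)
    = four_block_mat (mat_adjoint A) (mat_adjoint C) (mat_adjoint B) (mat_adjoint D)"
  using assms by (intro eq_matI) auto

lemma hermitian_diagonalization: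
  assumes "H \<in> carrier_mat n n" "mat_adjoint H = H"
    and "char_poly H = (\<Prod>e\<leftarrow>es. [:- e, 1:])"
  obtains P where "P \<in> carrier_mat n n" "mat_adjoint P * P = 1\<^sub>m n"
    "mat_adjoint P * (H * P) = diag n (\<lambda>i. es ! i)"
proof -
  have "\<exists>P \<in> carrier_mat n n. mat_adjoint P * P = 1\<^sub>m n \<and>
      mat_adjoint P * (H * P) = diag n (\<lambda>i. es ! i)"
    using assms
  proof (induction es arbitrary: n H)
    case Nil
    then have "n = 0" using degree_monic_char_poly[OF Nil(1)] by simp
    show ?case
      unfolding \<open>n = 0\<close> by (intro bexI[of _ "0\<^sub>m 0 0"] conjI eq_matI) auto
  next
    case (Cons e es n H)
    note H = Cons.prems(1)
    have "degree (char_poly H) \<noteq> 0"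
    proof -
      have monic: "monic (\<Prod>e\<leftarrow>es. [:- e, 1:])" by (rule monic_prod_list) auto
      then have "degree (char_poly H) = Suc (degree (\<Prod>e\<leftarrow>es. [:- e, 1:]))"
        unfolding Cons.prems(3) list.map prod_list.Cons by (subst degree_mult_eq) auto
      then show ?thesis by simp
    qed
    then obtain m where n: "n = Suc m"
      using degree_monic_char_poly[OF H] by (cases n) auto
    have "eigenvalue H e"
      unfolding eigenvalue_root_char_poly[OF H] Cons.prems(3) by simp
    then obtain v where v: "v \<in> carrier_vec n" "v \<noteq> 0\<^sub>v n" "H *\<^sub>v v = e \<cdot>\<^sub>v v"
      using H unfolding eigenvalue_def eigenvector_def by auto
    obtain W c where W: "W \<in> carrier_mat n n" "mat_adjoint W * W = 1\<^sub>m n"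
      and col: "col W 0 = c \<cdot>\<^sub>v v"
      using unitary_completion[OF v(1,2)] by blast
    have W': "W * mat_adjoint W = 1\<^sub>m n"
      by (rule mat_mult_left_right_inverse[OF mat_adjoint_carrier[OF W(1)] W])
    define K where "K = mat_adjoint W * (H * W)"
    have K: "K \<in> carrier_mat n n" using W H by (auto simp: K_def)
    have K_herm: "mat_adjoint K = K"
      using W H Cons.prems(2) unfolding K_def
      by (simp add: mat_adjoint_mult[where m = n and n = n and p = n] square_mult_assoc[where n = n])
    have "H *\<^sub>v col W 0 = e \<cdot>\<^sub>v col W 0"
      unfolding col using H v by (simp add: mult_mat_vec[OF H v(1)] smult_smult_assoc mult.commute)
    then have "col (H * W) 0 = e \<cdot>\<^sub>v col W 0"
      using H W n by (subst col_mult2[of _ n n _ n]) auto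
    then have "col K 0 = mat_adjoint W *\<^sub>v (e \<cdot>\<^sub>v col W 0)"
      unfolding K_def using H W n by (subst col_mult2[of _ n n _ n]) auto
    also have "\<dots> = e \<cdot>\<^sub>v (mat_adjoint W *\<^sub>v col W 0)"
      using W(1) n by (intro mult_mat_vec[of _ n n] mat_adjoint_carrier col_carrier_vec[of _ n]) auto
    also have "mat_adjoint W *\<^sub>v col W 0 = col (mat_adjoint W * W) 0"
      using W(1) n by (intro col_mult2[of _ n n _ n, symmetric] mat_adjoint_carrier) auto
    finally have K_col: "col K 0 = e \<cdot>\<^sub>v col (1\<^sub>m n) 0"
      by (simp add: W)
    have K0: "K $$ (i, 0) = (if i = 0 then e else 0)" if "i < n" for i
      using arg_cong[OF K_col, of "\<lambda>w. w $ i"] that K n by auto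
    have K0': "K $$ (0, j) = (if j = 0 then e else 0)" if j: "j < n" for j
    proof (cases "j = 0")
      case False
      have "K $$ (0, j) = cnj (K $$ (j, 0))"
        using arg_cong[OF K_herm, of "\<lambda>M. M $$ (0, j)"] K j n by simp
      then show ?thesis using K0[OF j] False by simp
    qed (use K0[of 0] n in simp)
    define L where "L = mat m m (\<lambda>(i, j). K $$ (Suc i, Suc j))"
    have L: "L \<in> carrier_mat m m" by (simp add: L_def)
    have K_block: "K = four_block_mat (mat 1 1 (\<lambda>_. e)) (0\<^sub>m 1 m) (0\<^sub>m m 1) L"
      using K n by (intro eq_matI) (auto simp: L_def K0 K0')
    have "mat_adjoint L = L"
    proof (rule eq_matI)
      fix i j assume "i < dim_row L" "j < dim_col L"
      then have ij: "i < m" "j < m" using L by auto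
      then show "mat_adjoint L $$ (i, j) = L $$ (i, j)"
        using arg_cong[OF K_herm, of "\<lambda>M. M $$ (Suc i, Suc j)"] K n by (simp add: L_def)
    qed (use L in auto)
    moreover have "char_poly L = (\<Prod>e\<leftarrow>es. [:- e, 1:])"
    proof -
      have "similar_mat_wit K H (mat_adjoint W) W"
        by (rule similar_mat_witI[OF W(2) W' _ K H mat_adjoint_carrier[OF W(1)] W(1)])
          (use W(1) H in \<open>simp add: K_def square_mult_assoc[where n = n]\<close>)
      then have "similar_mat K H"
        unfolding similar_mat_def by blast
      then have "char_poly H = char_poly K"
        by (simp add: char_poly_similar)
      also have "\<dots> = char_poly (mat 1 1 (\<lambda>_. e)) * char_poly L"
        unfolding K_block by (rule char_poly_four_block_zeros_col) (use L in auto)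
      also have "char_poly (mat 1 1 (\<lambda>_. e)) = [:- e, 1:]"
        by (simp add: char_poly_defs det_def sign_def)
      finally show ?thesis
        unfolding Cons.prems(3) list.map prod_list.Cons
        by (metis mult_cancel_left pCons_eq_0_iff zero_neq_one)
    qed
    ultimately obtain P where P: "P \<in> carrier_mat m m" "mat_adjoint P * P = 1\<^sub>m m"
      "mat_adjoint P * (L * P) = diag m (\<lambda>i. es ! i)"
      using Cons.IH[OF L] by blast
    define F where "F = four_block_mat (1\<^sub>m 1) (0\<^sub>m 1 m) (0\<^sub>m m 1) P"
    have F: "F \<in> carrier_mat n n"
      using four_block_carrier_mat[OF one_carrier_mat[of 1] P(1)] by (simp add: F_def n)
    have F_adj: "mat_adjoint F = four_block_mat (1\<^sub>m 1) (0\<^sub>m 1 m) (0\<^sub>m m 1) (mat_adjoint P)"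
      unfolding F_def using P(1)
      by (subst mat_adjoint_four_block[of _ 1 _ m]) (auto intro!: cong_four_block_mat eq_matI)
    have F_unitary: "mat_adjoint F * F = 1\<^sub>m n"
      unfolding F_adj unfolding F_def using P n
      by (subst mult_four_block_mat[of _ 1 1 _ m _ m _ _ 1 _ m]) auto
    have F_diag: "mat_adjoint F * (K * F) = diag n (\<lambda>i. (e # es) ! i)"
    proof -
      have "K * F = four_block_mat (mat 1 1 (\<lambda>_. e)) (0\<^sub>m 1 m) (0\<^sub>m m 1) (L * P)"
        unfolding K_block F_def using P L
        by (subst mult_four_block_mat[of _ 1 1 _ m _ m _ _ 1 _ m]) auto
      then have "mat_adjoint F * (K * F)
          = four_block_mat (mat 1 1 (\<lambda>_. e)) (0\<^sub>m 1 m) (0\<^sub>m m 1) (diag m (\<lambda>i. es ! i))"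
        unfolding F_adj using P L
        by (simp, subst mult_four_block_mat[of _ 1 1 _ m _ m _ _ 1 _ m]) auto
      also have "\<dots> = diag n (\<lambda>i. (e # es) ! i)"
        using n by (intro eq_matI) (auto simp: nth_Cons')
      finally show ?thesis .
    qed
    show ?case
    proof (intro bexI[of _ "W * F"] conjI)
      have "mat_adjoint (W * F) * (W * F) = mat_adjoint F * ((mat_adjoint W * W) * F)"
        using W(1) F
        by (simp add: mat_adjoint_mult[where m = n and n = n and p = n] square_mult_assoc[where n = n])
      then show "mat_adjoint (W * F) * (W * F) = 1\<^sub>m n"
        using W F F_unitary by simp
      have "mat_adjoint (W * F) * (H * (W * F)) = mat_adjoint F * (K * F)"
        using W(1) F H unfolding K_def
        by (simp add: mat_adjoint_mult[where m = n and n = n and p = n] square_mult_assoc[where n = n])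
      then show "mat_adjoint (W * F) * (H * (W * F)) = diag n (\<lambda>i. (e # es) ! i)"
        using F_diag by simp
    qed (use W F in auto)
  qed
  then show ?thesis using that by blast
qed

lemma singular_values_eigenvalues:
  assumes X: "X \<in> carrier_mat n n"
  obtains es where "length es = n" "char_poly (mat_adjoint X * X) = (\<Prod>e\<leftarrow>es. [:- e, 1:])"
    "\<And>i. i < n \<Longrightarrow> singular_values X $ i = sqrt (Re (es ! i))"
    "\<And>i j. i \<le> j \<Longrightarrow> j < n \<Longrightarrow> singular_values X $ j \<le> singular_values X $ i"
proof -
  let ?p = "char_poly (mat_adjoint X * X)" and ?f = "\<lambda>z. sqrt (Re z)"
  have H: "mat_adjoint X * X \<in> carrier_mat n n" using X by auto
  obtain xs where xs: "mset xs = proots ?p" using ex_mset by blast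
  define es where "es = rev (sort_key ?f xs)"
  have len: "length es = n"
    using arg_cong[OF xs, of size] degree_monic_char_poly[OF H]
    by (simp add: es_def size_proots_complex)
  have "sort (map ?f xs) = map ?f (sort_key ?f xs)"
    by (rule properties_for_sort) auto
  then have sv: "singular_values X = vec_of_list (rev (sort (map ?f xs)))"
    "rev (sort (map ?f xs)) = map ?f es"
    unfolding singular_values_def xs[symmetric] mset_map[symmetric] sorted_list_of_multiset_mset es_def
    by (simp_all add: rev_map)
  show ?thesis
  proof (rule that[OF len])
    have "?p = smult (lead_coeff ?p) (\<Prod>e\<in>#proots ?p. [:- e, 1:])"
      by (rule complex_poly_decompose_multiset[symmetric])
    also have "\<dots> = (\<Prod>e\<in>#mset es. [:- e, 1:])"
      using degree_monic_char_poly[OF H] by (simp add: es_def xs)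
    finally show "?p = (\<Prod>e\<leftarrow>es. [:- e, 1:])"
      by (simp add: prod_mset_prod_list flip: mset_map)
    show "singular_values X $ i = sqrt (Re (es ! i))" if "i < n" for i
      unfolding sv using that len by (simp add: vec_of_list_index)
    show "singular_values X $ j \<le> singular_values X $ i" if "i \<le> j" "j < n" for i j
    proof -
      have "length (sort (map ?f xs)) = n"
        using sv(2) len by (metis length_map length_rev)
      then show ?thesis
        unfolding sv(1) using that
        by (simp add: vec_of_list_index rev_nth) (intro sorted_nth_mono, auto)
    qed
  qed
qed

text \<open>Padding by zeros makes \<open>U\<close> only a partial isometry, so that no completion of its columns to an
  orthonormal basis is needed.\<close>

lemma singular_value_decomposition:
  assumes X: "X \<in> carrier_mat n n"
  obtains U V where "contraction n U" "contraction n V"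
    "X = U * (diag n (\<lambda>i. complex_of_real (singular_values X $ i)) * V)"
    "V * mat_adjoint V = 1\<^sub>m n"
    "mat_adjoint U * U * diag n (\<lambda>i. complex_of_real (singular_values X $ i))
      = diag n (\<lambda>i. complex_of_real (singular_values X $ i))"
    "\<And>i. i < n \<Longrightarrow> 0 \<le> singular_values X $ i"
proof -
  let ?H = "mat_adjoint X * X"
  define \<sigma> where "\<sigma> i = singular_values X $ i" for i
  obtain es where es: "char_poly ?H = (\<Prod>e\<leftarrow>es. [:- e, 1:])"
    and \<sigma>: "\<And>i. i < n \<Longrightarrow> \<sigma> i = sqrt (Re (es ! i))"
    by (rule singular_values_eigenvalues[OF X]) (rule that; simp add: \<sigma>_def)
  have H: "?H \<in> carrier_mat n n" using X by simp
  have H_herm: "mat_adjoint ?H = ?H"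
    using X by (simp add: mat_adjoint_mult[where m = n and n = n and p = n])
  obtain P where P: "P \<in> carrier_mat n n" "mat_adjoint P * P = 1\<^sub>m n"
    and PHP: "mat_adjoint P * (?H * P) = diag n (\<lambda>i. es ! i)"
    by (rule hermitian_diagonalization[OF H H_herm es])
  have P': "P * mat_adjoint P = 1\<^sub>m n"
    by (rule mat_mult_left_right_inverse[OF mat_adjoint_carrier[OF P(1)] P])
  define M where "M = X * P"
  have M: "M \<in> carrier_mat n n" using X P by (auto simp: M_def)
  have gram: "mat_adjoint M * M = diag n (\<lambda>i. es ! i)"
    unfolding M_def PHP[symmetric] using X P(1)
    by (simp add: mat_adjoint_mult[where m = n and n = n and p = n] square_mult_assoc[where n = n])
  have es_eq: "es ! i = complex_of_real (\<Sum>l<n. (cmod (M $$ (l, i)))\<^sup>2)" if i: "i < n" for i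
  proof -
    have "es ! i = (mat_adjoint M * M) $$ (i, i)" using i by (simp add: gram)
    also have "\<dots> = (\<Sum>l<n. mat_adjoint M $$ (i, l) * M $$ (l, i))"
      using M i by (intro index_mult_mat_sum) auto
    also have "\<dots> = (\<Sum>l<n. complex_of_real ((cmod (M $$ (l, i)))\<^sup>2))"
      using M i by (intro sum.cong) (auto simp: complex_norm_square simp del: of_real_power)
    finally show ?thesis by simp
  qed
  have \<sigma>_nonneg: "0 \<le> \<sigma> i" and \<sigma>_sq: "(\<sigma> i)\<^sup>2 = (\<Sum>l<n. (cmod (M $$ (l, i)))\<^sup>2)" if i: "i < n" for i
  proof -
    have "\<sigma> i = sqrt (\<Sum>l<n. (cmod (M $$ (l, i)))\<^sup>2)"
      by (simp only: \<sigma>[OF i] es_eq[OF i] Re_complex_of_real)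
    then show "0 \<le> \<sigma> i" "(\<sigma> i)\<^sup>2 = (\<Sum>l<n. (cmod (M $$ (l, i)))\<^sup>2)"
      by (simp_all add: sum_nonneg)
  qed
  let ?D = "diag n (\<lambda>i. complex_of_real (\<sigma> i))"
  \<comment> \<open>As \<open>1 / 0 = 0\<close>, this is the pseudoinverse of the diagonal factor.\<close>
  define D' where "D' = diag n (\<lambda>i. complex_of_real (1 / \<sigma> i))"
  have D' [simp]: "D' \<in> carrier_mat n n" "mat_adjoint D' = D'"
    by (simp_all add: D'_def mat_adjoint_diag)
  define U where "U = M * D'"
  have U: "U \<in> carrier_mat n n" using M by (simp add: U_def)
  have U_gram: "mat_adjoint U * U = diag n (\<lambda>i. complex_of_real (if \<sigma> i = 0 then 0 else 1))"
  proof -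
    have "mat_adjoint U * U = D' * ((mat_adjoint M * M) * D')"
      unfolding U_def using M
      by (simp add: mat_adjoint_mult[where m = n and n = n and p = n] square_mult_assoc[where n = n])
    also have "\<dots> = diag n (\<lambda>i. complex_of_real (1 / \<sigma> i) * (es ! i * complex_of_real (1 / \<sigma> i)))"
      by (simp only: gram D'_def diag_mult_diag)
    also have "\<dots> = diag n (\<lambda>i. complex_of_real (if \<sigma> i = 0 then 0 else 1))"
    proof (rule diag_cong)
      fix i assume "i < n"
      then have "es ! i = complex_of_real ((\<sigma> i)\<^sup>2)"
        by (simp only: es_eq \<sigma>_sq)
      then show "complex_of_real (1 / \<sigma> i) * (es ! i * complex_of_real (1 / \<sigma> i))
          = complex_of_real (if \<sigma> i = 0 then 0 else 1)"
        by (simp add: power2_eq_square)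
    qed
    finally show ?thesis .
  qed
  have "contraction n U"
    using U U_gram by (rule contraction_if_gram_diag) auto
  moreover have "contraction n (mat_adjoint P)"
  proof (rule contraction_adjoint, rule contraction_if_gram_diag[OF P(1)])
    show "mat_adjoint P * P = diag n (\<lambda>i. complex_of_real 1)"
      using P by (simp add: diag_one)
  qed simp
  moreover have "X = U * (?D * mat_adjoint P)"
  proof -
    have "U * ?D = M"
    proof (rule eq_matI)
      fix i j assume "i < dim_row M" "j < dim_col M"
      then have ij: "i < n" "j < n" using M by auto
      have "M $$ (i, j) = 0" if "\<sigma> j = 0"
      proof -
        have "(\<Sum>l<n. (cmod (M $$ (l, j)))\<^sup>2) = 0"
          using \<sigma>_sq[OF ij(2)] that by simp
        then show ?thesis
          using ij by (simp add: sum_nonneg_eq_0_iff)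
      qed
      then show "(U * ?D) $$ (i, j) = M $$ (i, j)"
        using M U ij unfolding index_mult_diag[OF U ij] unfolding U_def D'_def index_mult_diag[OF M ij]
        by auto
    qed (use M U in auto)
    moreover have "U * (?D * mat_adjoint P) = (U * ?D) * mat_adjoint P"
      using U P by (simp add: square_mult_assoc[where n = n])
    moreover have "M * mat_adjoint P = X"
      using X P P' unfolding M_def by (simp add: square_mult_assoc[where n = n])
    ultimately show ?thesis by simp
  qed
  moreover have "mat_adjoint P * mat_adjoint (mat_adjoint P) = 1\<^sub>m n"
    using P by simp
  moreover have "mat_adjoint U * U * ?D = ?D"
    unfolding U_gram diag_mult_diag by (rule diag_cong) auto
  ultimately show ?thesis
    using that \<sigma>_nonneg unfolding \<sigma>_def by blast
qed

lemma singular_values_nonneg: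
  "X \<in> carrier_mat n n \<Longrightarrow> i < n \<Longrightarrow> 0 \<le> singular_values X $ i"
  using singular_value_decomposition by blast

lemma singular_values_antimono:
  "X \<in> carrier_mat n n \<Longrightarrow> i \<le> j \<Longrightarrow> j < n \<Longrightarrow> singular_values X $ j \<le> singular_values X $ i"
  using singular_values_eigenvalues by blast

section \<open>Ky Fan norms\<close>

lemma sum_mult_mono_partial_sums:
  fixes s t d :: "nat \<Rightarrow> real"
  assumes antimono: "\<And>i j. i \<le> j \<Longrightarrow> j < n \<Longrightarrow> s j \<le> s i"
    and nonneg: "\<And>i. i < n \<Longrightarrow> 0 \<le> s i"
    and le: "\<And>j. j \<le> n \<Longrightarrow> (\<Sum>i<j. t i) \<le> (\<Sum>i<j. d i)"
  shows "(\<Sum>i<n. s i * t i) \<le> (\<Sum>i<n. s i * d i)"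
proof -
  define c where "c i = d i - t i" for i
  have C: "0 \<le> (\<Sum>i<j. c i)" if "j \<le> n" for j
    using le[OF that] by (simp add: c_def sum_subtractf)
  have "s m * (\<Sum>i<Suc m. c i) \<le> (\<Sum>i<Suc m. s i * c i)" if "m < n" for m
    using that
  proof (induction m)
    case (Suc m)
    have "s (Suc m) * (\<Sum>i<Suc m. c i) \<le> s m * (\<Sum>i<Suc m. c i)"
      using antimono[of m "Suc m"] C[of "Suc m"] Suc.prems by (intro mult_right_mono) auto
    also have "\<dots> \<le> (\<Sum>i<Suc m. s i * c i)"
      using Suc by simp
    finally show ?case
      by (simp only: sum.lessThan_Suc[of _ "Suc m"] distrib_left add_le_cancel_right)
  qed simp
  note partial = this
  have "0 \<le> (\<Sum>i<n. s i * c i)"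
  proof (cases n)
    case (Suc m)
    have "0 \<le> s m * (\<Sum>i<Suc m. c i)"
      using nonneg[of m] C[of n] Suc by (intro mult_nonneg_nonneg) auto
    also have "\<dots> \<le> (\<Sum>i<Suc m. s i * c i)"
      using partial[of m] Suc by simp
    finally show ?thesis using Suc by simp
  qed simp
  then show ?thesis
    by (simp add: c_def right_diff_distrib sum_subtractf)
qed

lemma trace_diag_mult:
  assumes "A \<in> carrier_mat n n"
  shows "trace (diag n f * A) = (\<Sum>i<n. f i * A $$ (i, i))"
  unfolding trace_def using assms
  by (intro sum.cong) (auto simp: index_diag_mult simp del: index_mult_mat(1))

text \<open>With \<open>ky_fan_norm_attained\<close>, this is Ky Fan's variational characterization.\<close>

lemma trace_le_ky_fan_norm:
  assumes A: "A \<in> carrier_mat n n" and Q: "truncated_contraction n r Q" and r: "r \<le> n"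
  shows "Re (trace (A * Q)) \<le> ky_fan_norm r A"
proof -
  define \<sigma> where "\<sigma> i = singular_values A $ i" for i
  obtain U V where UV: "contraction n U" "contraction n V"
    and svd: "A = U * (diag n (\<lambda>i. complex_of_real (\<sigma> i)) * V)"
    using singular_value_decomposition[OF A] unfolding \<sigma>_def by blast
  note [simp] = UV[THEN contraction_carrier] truncated_contraction_carrier[OF Q]
  have VQU: "truncated_contraction n r (V * Q * U)"
    using truncated_contraction_mult_right[OF truncated_contraction_mult_left[OF Q UV(2)] UV(1)] .
  have "trace (A * Q) = trace (U * (diag n (\<lambda>i. complex_of_real (\<sigma> i)) * V * Q))"
    unfolding svd by (simp add: square_mult_assoc[where n = n])
  also have "\<dots> = trace (diag n (\<lambda>i. complex_of_real (\<sigma> i)) * (V * Q * U))"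
    by (subst trace_comm[of _ n n]) (auto simp: square_mult_assoc[where n = n])
  also have "\<dots> = (\<Sum>l<n. complex_of_real (\<sigma> l) * (V * Q * U) $$ (l, l))"
    by (rule trace_diag_mult) simp
  finally have "Re (trace (A * Q)) = (\<Sum>l<n. \<sigma> l * Re ((V * Q * U) $$ (l, l)))"
    by (simp only: Re_sum Re_complex_of_real times_complex.sel Im_complex_of_real mult_zero_left
        diff_zero)
  also have "\<dots> \<le> (\<Sum>l<n. \<sigma> l * (if l < r then 1 else 0))"
  proof (rule sum_mult_mono_partial_sums)
    fix j assume j: "j \<le> n"
    let ?c = "\<lambda>l. cmod ((V * Q * U) $$ (l, l))"
    have "(\<Sum>l<j. Re ((V * Q * U) $$ (l, l))) \<le> (\<Sum>l<j. ?c l)"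
      by (intro sum_mono complex_Re_le_cmod)
    also have "\<dots> \<le> real (min j r)"
    proof -
      have "(\<Sum>l<j. ?c l) \<le> (\<Sum>l<j. 1)"
        using truncated_contraction_diagonal(1)[OF VQU] j by (intro sum_mono) auto
      moreover have "(\<Sum>l<j. ?c l) \<le> (\<Sum>l<n. ?c l)"
        using j by (intro sum_mono2) auto
      ultimately show ?thesis
        using truncated_contraction_diagonal(2)[OF VQU] by simp
    qed
    also have "real (min j r) = (\<Sum>l<j. if l < r then 1 else 0)"
    proof -
      have "(\<Sum>l<j. if l < r then 1 else 0) = (\<Sum>l<min j r. 1::real)"
        by (intro sum.mono_neutral_cong_right) auto
      then show ?thesis by simp
    qed
    finally show "(\<Sum>l<j. Re ((V * Q * U) $$ (l, l))) \<le> (\<Sum>l<j. if l < r then 1 else 0)" .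
  qed (use singular_values_nonneg[OF A] singular_values_antimono[OF A] in \<open>auto simp: \<sigma>_def\<close>)
  also have "\<dots> = (\<Sum>l<r. \<sigma> l)"
    using r by (intro sum.mono_neutral_cong_right) auto
  finally show ?thesis
    by (simp add: ky_fan_norm_def \<sigma>_def)
qed

lemma ky_fan_norm_attained:
  assumes A: "A \<in> carrier_mat n n" and k: "k \<le> n"
  obtains W where "truncated_contraction n k W" "Re (trace (A * W)) = ky_fan_norm k A"
proof -
  define \<sigma> where "\<sigma> i = singular_values A $ i" for i
  let ?D = "diag n (\<lambda>i. complex_of_real (\<sigma> i))"
  obtain U V where UV: "contraction n U" "contraction n V"
    and svd: "A = U * (?D * V)" and V: "V * mat_adjoint V = 1\<^sub>m n"
    and U: "mat_adjoint U * U * ?D = ?D"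
    using singular_value_decomposition[OF A] unfolding \<sigma>_def by blast
  note [simp] = UV[THEN contraction_carrier]
  let ?W = "mat_adjoint V * truncation n k * mat_adjoint U"
  have "trace (A * ?W)
      = trace (U * (?D * ((V * mat_adjoint V) * (truncation n k * mat_adjoint U))))"
    unfolding svd by (simp add: square_mult_assoc[where n = n])
  also have "\<dots> = trace ((U * (?D * truncation n k)) * mat_adjoint U)"
    unfolding V by (simp add: square_mult_assoc[where n = n] left_mult_one_mat[of _ n n])
  also have "\<dots> = trace (mat_adjoint U * U * ?D * truncation n k)"
    by (subst trace_comm[of _ n n]) (auto simp: square_mult_assoc[where n = n])
  also have "\<dots> = (\<Sum>i<n. complex_of_real (\<sigma> i) * truncation n k $$ (i, i))"
    unfolding U by (rule trace_diag_mult) simp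
  also have "\<dots> = (\<Sum>i<k. complex_of_real (\<sigma> i))"
    using k by (intro sum.mono_neutral_cong_right) (auto simp: truncation_def)
  finally have "Re (trace (A * ?W)) = ky_fan_norm k A"
    by (simp add: ky_fan_norm_def \<sigma>_def)
  moreover have "truncated_contraction n k ?W"
    using UV[THEN contraction_adjoint] unfolding truncated_contraction_def by blast
  ultimately show ?thesis using that by blast
qed

lemma truncated_contraction_imp_contraction:
  "truncated_contraction n r Q \<Longrightarrow> contraction n Q"
  by (auto simp: truncated_contraction_def intro!: contraction_mult contraction_truncation)

lemma truncated_contraction_truncation:
  "contraction n S \<Longrightarrow> contraction n T \<Longrightarrow> truncated_contraction n r (S * truncation n r * T)"
  by (auto simp: truncated_contraction_def)

lemma trace_shift_mult:
  assumes "A \<in> carrier_mat n n" "Q \<in> carrier_mat n n"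
  shows "trace ((A - \<alpha> \<cdot>\<^sub>m 1\<^sub>m n) * Q) = trace (A * Q) - \<alpha> * trace Q"
proof -
  have "(A - \<alpha> \<cdot>\<^sub>m 1\<^sub>m n) * Q = A * Q - (\<alpha> \<cdot>\<^sub>m 1\<^sub>m n) * Q"
    using assms by (intro minus_mult_distrib_mat[of _ n n]) auto
  also have "(\<alpha> \<cdot>\<^sub>m 1\<^sub>m n) * Q = \<alpha> \<cdot>\<^sub>m Q"
    using assms by (subst mult_smult_assoc_mat[of _ n n]) auto
  finally show ?thesis
    using assms by (simp add: trace_minus[where n = n] trace_smult[where n = n])
qed

lemma norm_trace_truncated_contraction_le:
  assumes "truncated_contraction n r Q"
  shows "cmod (trace Q) \<le> real r"
proof -
  have "cmod (trace Q) \<le> (\<Sum>l<n. cmod (Q $$ (l, l)))"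
    using truncated_contraction_carrier[OF assms] norm_sum[of "\<lambda>l. Q $$ (l, l)" "{..<n}"]
    by (simp add: trace_def)
  then show ?thesis
    using truncated_contraction_diagonal(2)[OF assms] by linarith
qed

lemma ky_fan_norm_shift_le:
  assumes A: "A \<in> carrier_mat n n" and k: "k \<le> n"
  shows "ky_fan_norm k (A - \<alpha> \<cdot>\<^sub>m 1\<^sub>m n)
    \<le> ky_fan_norm k (A - \<beta> \<cdot>\<^sub>m 1\<^sub>m n) + real k * cmod (\<alpha> - \<beta>)"
proof -
  have shift: "A - \<gamma> \<cdot>\<^sub>m 1\<^sub>m n \<in> carrier_mat n n" for \<gamma> using A by auto
  obtain W where W: "truncated_contraction n k W"
    and attained: "Re (trace ((A - \<alpha> \<cdot>\<^sub>m 1\<^sub>m n) * W)) = ky_fan_norm k (A - \<alpha> \<cdot>\<^sub>m 1\<^sub>m n)"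
    using ky_fan_norm_attained[OF shift k] by blast
  note W_carrier = truncated_contraction_carrier[OF W]
  have "trace ((A - \<alpha> \<cdot>\<^sub>m 1\<^sub>m n) * W) = trace ((A - \<beta> \<cdot>\<^sub>m 1\<^sub>m n) * W) + (\<beta> - \<alpha>) * trace W"
    by (simp add: trace_shift_mult[OF A W_carrier] algebra_simps)
  then have "ky_fan_norm k (A - \<alpha> \<cdot>\<^sub>m 1\<^sub>m n)
      = Re (trace ((A - \<beta> \<cdot>\<^sub>m 1\<^sub>m n) * W)) + Re ((\<beta> - \<alpha>) * trace W)"
    by (metis attained plus_complex.sel(1))
  moreover have "Re (trace ((A - \<beta> \<cdot>\<^sub>m 1\<^sub>m n) * W)) \<le> ky_fan_norm k (A - \<beta> \<cdot>\<^sub>m 1\<^sub>m n)"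
    by (rule trace_le_ky_fan_norm[OF shift W k])
  moreover have "Re ((\<beta> - \<alpha>) * trace W) \<le> real k * cmod (\<alpha> - \<beta>)"
  proof -
    have "Re ((\<beta> - \<alpha>) * trace W) \<le> cmod (\<alpha> - \<beta>) * cmod (trace W)"
      using complex_Re_le_cmod[of "(\<beta> - \<alpha>) * trace W"] by (simp add: norm_mult norm_minus_commute)
    also have "\<dots> \<le> cmod (\<alpha> - \<beta>) * real k"
      by (intro mult_left_mono norm_trace_truncated_contraction_le[OF W]) simp
    finally show ?thesis by (simp add: mult.commute)
  qed
  ultimately show ?thesis by linarith
qed

lemma ky_fan_norm_shift_ge:
  assumes A: "A \<in> carrier_mat n n" and k: "k \<le> n"
  shows "real k * cmod \<alpha> - ky_fan_norm k A \<le> ky_fan_norm k (A - \<alpha> \<cdot>\<^sub>m 1\<^sub>m n)"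
proof -
  define c where "c = - sgn (cnj \<alpha>)"
  define Q where "Q = c \<cdot>\<^sub>m truncation n k"
  have "\<alpha> * sgn (cnj \<alpha>) = complex_of_real (cmod \<alpha>)"
    by (cases "\<alpha> = 0") (simp_all add: sgn_eq power2_eq_square flip: complex_norm_square)
  then have c: "cmod c \<le> 1" "- \<alpha> * c = complex_of_real (cmod \<alpha>)"
    by (simp_all add: c_def norm_sgn)
  have one: "contraction n (1\<^sub>m n)"
    unfolding diag_one[symmetric] by (rule contraction_diag) simp
  have trunc: "truncated_contraction n k (truncation n k)"
    using truncated_contraction_truncation[OF one one, of k]
    by (simp add: left_mult_one_mat[of _ n n] right_mult_one_mat[of _ n n])
  have Q: "truncated_contraction n k Q"
    unfolding Q_def by (rule truncated_contraction_smult[OF trunc c(1)])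
  have mQ: "truncated_contraction n k (- 1 \<cdot>\<^sub>m Q)"
    by (rule truncated_contraction_smult[OF Q]) simp
  note Q_carrier = truncated_contraction_carrier[OF Q]
  have "trace Q = c * of_nat k"
  proof -
    have "trace (truncation n k) = (\<Sum>i<k. 1)"
      unfolding trace_def truncation_def using k by (intro sum.mono_neutral_cong_right) auto
    then show ?thesis
      unfolding Q_def by (simp add: trace_smult[where n = n])
  qed
  then have "trace ((A - \<alpha> \<cdot>\<^sub>m 1\<^sub>m n) * Q) = trace (A * Q) + (- \<alpha> * c) * of_nat k"
    by (simp add: trace_shift_mult[OF A Q_carrier])
  then have "Re (trace ((A - \<alpha> \<cdot>\<^sub>m 1\<^sub>m n) * Q)) = Re (trace (A * Q)) + cmod \<alpha> * real k"
    unfolding c(2) by simp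
  moreover have "Re (trace ((A - \<alpha> \<cdot>\<^sub>m 1\<^sub>m n) * Q)) \<le> ky_fan_norm k (A - \<alpha> \<cdot>\<^sub>m 1\<^sub>m n)"
    by (rule trace_le_ky_fan_norm[OF _ Q k]) (use A in auto)
  moreover have "- Re (trace (A * Q)) \<le> ky_fan_norm k A"
  proof -
    have "A * (- 1 \<cdot>\<^sub>m Q) = - 1 \<cdot>\<^sub>m (A * Q)"
      by (rule mult_smult_distrib[OF A Q_carrier])
    then have "trace (A * (- 1 \<cdot>\<^sub>m Q)) = - trace (A * Q)"
      using A Q_carrier by (simp only: trace_smult[of "A * Q" n] square_mult_carrier) simp
    then show ?thesis
      using trace_le_ky_fan_norm[OF A mQ k] by simp
  qed
  ultimately show ?thesis by (simp add: mult.commute)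
qed

lemma attains_inf_complex:
  fixes g :: "complex \<Rightarrow> real"
  assumes cont: "\<And>z. isCont g z" and outside: "\<And>z. cmod z > R \<Longrightarrow> g 0 \<le> g z" and R: "0 \<le> R"
  obtains z0 where "\<And>z. g z0 \<le> g z"
proof -
  define K where "K = (\<lambda>p. complex_of_real (fst p) + \<i> * complex_of_real (snd p)) ` ({-R..R} \<times> {-R..R})"
  have "compact K"
    unfolding K_def by (intro compact_continuous_image continuous_intros compact_Times compact_Icc)
  moreover have mem: "z \<in> K" if "cmod z \<le> R" for z
    unfolding K_def using that abs_Re_le_cmod[of z] abs_Im_le_cmod[of z]
    by (intro image_eqI[of _ _ "(Re z, Im z)"]) (auto simp: complex_eq_iff)
  moreover have "continuous_on K g"
    by (intro continuous_at_imp_continuous_on ballI cont)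
  ultimately obtain z0 where z0: "\<And>z. z \<in> K \<Longrightarrow> g z0 \<le> g z"
    using continuous_attains_inf[of K g] R by (metis empty_iff norm_zero)
  have "g z0 \<le> g z" for z
  proof (cases "cmod z \<le> R")
    case True
    then show ?thesis using z0[OF mem] by simp
  next
    case False
    then show ?thesis using z0[OF mem[of 0]] outside[of z] R by simp
  qed
  then show ?thesis using that by blast
qed

lemma delta_sum_attained:
  assumes A: "A \<in> carrier_mat n n" and B: "B \<in> carrier_mat n n" and k: "k \<le> n"
  obtains \<alpha> where "2 * delta_sum k A B
    = ky_fan_norm k (A - \<alpha> \<cdot>\<^sub>m 1\<^sub>m n) + ky_fan_norm k (B - \<alpha> \<cdot>\<^sub>m 1\<^sub>m n)"
proof -
  define g where
    "g \<alpha> = (ky_fan_norm k (A - \<alpha> \<cdot>\<^sub>m 1\<^sub>m n) + ky_fan_norm k (B - \<alpha> \<cdot>\<^sub>m 1\<^sub>m n)) / 2" for \<alpha>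
  have "\<exists>\<alpha>0. \<forall>\<alpha>. g \<alpha>0 \<le> g \<alpha>"
  proof (cases "k = 0")
    case True
    then show ?thesis by (simp add: g_def ky_fan_norm_def)
  next
    case False
    define C where "C = (ky_fan_norm k A + ky_fan_norm k B) / 2"
    have lipschitz: "\<bar>g \<alpha> - g \<beta>\<bar> \<le> real k * cmod (\<alpha> - \<beta>)" for \<alpha> \<beta>
      using ky_fan_norm_shift_le[OF A k, of \<alpha> \<beta>] ky_fan_norm_shift_le[OF A k, of \<beta> \<alpha>]
        ky_fan_norm_shift_le[OF B k, of \<alpha> \<beta>] ky_fan_norm_shift_le[OF B k, of \<beta> \<alpha>]
      unfolding g_def norm_minus_commute[of \<beta> \<alpha>] by (simp add: abs_le_iff field_simps)
    have cont: "isCont g \<alpha>" for \<alpha>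
    proof -
      have "((\<lambda>\<beta>. real k * cmod (\<beta> - \<alpha>)) \<longlongrightarrow> real k * cmod (\<alpha> - \<alpha>)) (at \<alpha>)"
        by (intro tendsto_intros)
      then have lim: "((\<lambda>\<beta>. real k * cmod (\<beta> - \<alpha>)) \<longlongrightarrow> 0) (at \<alpha>)" by simp
      have "((\<lambda>\<beta>. \<bar>g \<beta> - g \<alpha>\<bar>) \<longlongrightarrow> 0) (at \<alpha>)"
        by (rule real_LIM_sandwich_zero[OF lim]) (use lipschitz in auto)
      then show ?thesis
        unfolding isCont_def by (simp add: tendsto_rabs_zero_iff LIM_zero_iff)
    qed
    have coercive: "real k * cmod \<alpha> - C \<le> g \<alpha>" for \<alpha>
      using ky_fan_norm_shift_ge[OF A k, of \<alpha>] ky_fan_norm_shift_ge[OF B k, of \<alpha>]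
      unfolding g_def C_def by (simp add: field_simps)
    have "A - 0 \<cdot>\<^sub>m 1\<^sub>m n = A" "B - 0 \<cdot>\<^sub>m 1\<^sub>m n = B"
      using A B by (auto intro!: eq_matI)
    then have g0: "g 0 = C" by (simp add: g_def C_def)
    obtain \<alpha>0 where "\<And>\<alpha>. g \<alpha>0 \<le> g \<alpha>"
    proof (rule attains_inf_complex[of g "\<bar>2 * C / real k\<bar>"])
      fix \<alpha> :: complex assume "\<bar>2 * C / real k\<bar> < cmod \<alpha>"
      then have "2 * C / real k < cmod \<alpha>" by linarith
      then have "2 * C < real k * cmod \<alpha>"
        using False by (simp add: field_simps)
      then show "g 0 \<le> g \<alpha>" using coercive[of \<alpha>] g0 by linarith
    qed (use cont in auto)
    then show ?thesis by blast
  qed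
  then obtain \<alpha>0 where \<alpha>0: "\<And>\<alpha>. g \<alpha>0 \<le> g \<alpha>" by blast
  have "delta_sum k A B = (LEAST r. r \<in> range g)"
    using A B by (simp add: delta_sum_def g_def[abs_def])
  also have "\<dots> = g \<alpha>0"
    by (rule Least_equality) (use \<alpha>0 in auto)
  finally show ?thesis using that[of \<alpha>0] by (simp add: g_def)
qed

lemma ky_fan_norm_sylvester_le:
  assumes A: "A \<in> carrier_mat n n" and B: "B \<in> carrier_mat n n" and X: "X \<in> carrier_mat n n"
    and k: "k \<le> n"
  shows "ky_fan_norm k (A * X - X * B) \<le> (\<Sum>i<k. 2 * (delta_vec A B $ i * singular_values X $ i))"
proof -
  define \<sigma> where "\<sigma> i = singular_values X $ i" for i
  let ?D = "diag n (\<lambda>i. complex_of_real (\<sigma> i))"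
  note [simp] = A B X
  have Y: "A * X - X * B \<in> carrier_mat n n"
    by (intro minus_carrier_mat square_mult_carrier X B)
  obtain W where W: "truncated_contraction n k W"
    and attained: "Re (trace ((A * X - X * B) * W)) = ky_fan_norm k (A * X - X * B)"
    using ky_fan_norm_attained[OF Y k] by blast
  obtain U V where UV: "contraction n U" "contraction n V" and svd: "X = U * (?D * V)"
    using singular_value_decomposition[OF X] unfolding \<sigma>_def by blast
  note W' = truncated_contraction_imp_contraction[OF W]
  note [simp] = UV[THEN contraction_carrier] truncated_contraction_carrier[OF W]
  define G where "G = V * W * A * U"
  define H where "H = V * B * W * U"
  have [simp]: "G \<in> carrier_mat n n" "H \<in> carrier_mat n n" by (simp_all add: G_def H_def)
  define t where "t l = Re (G $$ (l, l)) - Re (H $$ (l, l))" for l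
  have "trace ((A * X - X * B) * W) = trace (A * X * W) - trace (X * B * W)"
    by (simp add: minus_mult_distrib_mat[of _ n n _ _ n] trace_minus[where n = n])
  also have "trace (A * X * W) = trace ((A * U) * (?D * (V * W)))"
    unfolding svd by (simp add: square_mult_assoc[where n = n])
  also have "\<dots> = trace (?D * G)"
    unfolding G_def by (subst trace_comm[of _ n n]) (simp_all add: square_mult_assoc[where n = n])
  also have "trace (X * B * W) = trace (U * (?D * (V * B * W)))"
    unfolding svd by (simp add: square_mult_assoc[where n = n])
  also have "\<dots> = trace (?D * H)"
    unfolding H_def by (subst trace_comm[of _ n n]) (simp_all add: square_mult_assoc[where n = n])
  finally have "ky_fan_norm k (A * X - X * B) = (\<Sum>l<n. \<sigma> l * t l)"
    unfolding attained[symmetric] t_def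
    by (simp add: trace_diag_mult[where n = n] right_diff_distrib sum_subtractf)
  also have "\<dots> \<le> (\<Sum>l<n. \<sigma> l * (if l < k then 2 * delta_vec A B $ l else 0))"
  proof (rule sum_mult_mono_partial_sums)
    fix j assume j: "j \<le> n"
    define m where "m = min j k"
    define P where "P = U * truncation n j * V"
    have P: "contraction n P"
      unfolding P_def by (intro contraction_mult UV contraction_truncation)
    note [simp] = contraction_carrier[OF P]
    have m: "m \<le> n" using k by (simp add: m_def)
    have PW: "truncated_contraction n m (P * W)" and WP: "truncated_contraction n m (W * P)"
    proof -
      have "truncated_contraction n j P"
        unfolding P_def by (rule truncated_contraction_truncation[OF UV])
      then show "truncated_contraction n m (P * W)" "truncated_contraction n m (W * P)"
        using truncated_contraction_mult_left[OF W P] truncated_contraction_mult_right[OF W P]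
          truncated_contraction_mult_left[OF _ W'] truncated_contraction_mult_right[OF _ W']
        unfolding m_def min_def by auto
    qed
    have mWP: "truncated_contraction n m (- 1 \<cdot>\<^sub>m (W * P))"
      by (rule truncated_contraction_smult[OF WP]) simp
    have trace_trunc: "trace (truncation n j * M) = (\<Sum>l<j. M $$ (l, l))"
      if "M \<in> carrier_mat n n" for M
    proof -
      have "trace (truncation n j * M) = (\<Sum>l<n. (if l < j then 1 else 0) * M $$ (l, l))"
        unfolding truncation_def by (rule trace_diag_mult[OF that])
      also have "\<dots> = (\<Sum>l<j. M $$ (l, l))"
        using j by (intro sum.mono_neutral_cong_right) auto
      finally show ?thesis .
    qed
    obtain \<alpha> where \<alpha>: "2 * delta_sum m A B
        = ky_fan_norm m (A - \<alpha> \<cdot>\<^sub>m 1\<^sub>m n) + ky_fan_norm m (B - \<alpha> \<cdot>\<^sub>m 1\<^sub>m n)"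
      by (rule delta_sum_attained[OF A B m])
    have shift: "A - \<alpha> \<cdot>\<^sub>m 1\<^sub>m n \<in> carrier_mat n n" "B - \<alpha> \<cdot>\<^sub>m 1\<^sub>m n \<in> carrier_mat n n"
      by (simp_all add: minus_carrier_mat)
    have "(\<Sum>l<j. t l) = Re (trace (truncation n j * G)) - Re (trace (truncation n j * H))"
      by (simp add: trace_trunc t_def sum_subtractf)
    also have "trace (truncation n j * G) = trace (truncation n j * (V * W * A) * U)"
      unfolding G_def by (simp add: square_mult_assoc[where n = n])
    also have "\<dots> = trace (P * W * A)"
      unfolding P_def by (subst trace_comm[of _ n n]) (simp_all add: square_mult_assoc[where n = n])
    also have "\<dots> = trace (A * (P * W))"
      by (rule trace_comm[of _ n n]) simp_all
    also have "trace (truncation n j * H) = trace (truncation n j * V * (B * W * U))"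
      unfolding H_def by (simp add: square_mult_assoc[where n = n])
    also have "\<dots> = trace (B * (W * P))"
      unfolding P_def by (subst trace_comm[of _ n n]) (simp_all add: square_mult_assoc[where n = n])
    also have "Re (trace (A * (P * W))) - Re (trace (B * (W * P)))
        = Re (trace ((A - \<alpha> \<cdot>\<^sub>m 1\<^sub>m n) * (P * W)))
          + Re (trace ((B - \<alpha> \<cdot>\<^sub>m 1\<^sub>m n) * (- 1 \<cdot>\<^sub>m (W * P))))"
    proof -
      have "trace ((A - \<alpha> \<cdot>\<^sub>m 1\<^sub>m n) * (P * W)) = trace (A * (P * W)) - \<alpha> * trace (P * W)"
        by (rule trace_shift_mult) simp_all
      moreover have "trace ((B - \<alpha> \<cdot>\<^sub>m 1\<^sub>m n) * (- 1 \<cdot>\<^sub>m (W * P)))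
          = - (trace (B * (W * P)) - \<alpha> * trace (W * P))"
      proof -
        have "(B - \<alpha> \<cdot>\<^sub>m 1\<^sub>m n) * (- 1 \<cdot>\<^sub>m (W * P)) = - 1 \<cdot>\<^sub>m ((B - \<alpha> \<cdot>\<^sub>m 1\<^sub>m n) * (W * P))"
          by (rule mult_smult_distrib[OF shift(2), of _ n]) simp
        then show ?thesis
          using trace_shift_mult[OF B, of "W * P" \<alpha>]
            trace_smult[OF square_mult_carrier[OF shift(2)], of "W * P" "- 1"] by simp
      qed
      moreover have "trace (P * W) = trace (W * P)"
        by (rule trace_comm[of _ n n]) simp_all
      ultimately show ?thesis by simp
    qed
    also have "\<dots> \<le> 2 * delta_sum m A B"
      unfolding \<alpha>
      by (intro add_mono trace_le_ky_fan_norm[OF shift(1) PW m] trace_le_ky_fan_norm[OF shift(2) mWP m])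
    also have "\<dots> = 2 * (\<Sum>l<m. delta_vec A B $ l)"
      by (simp only: sum_delta_vec[OF A m])
    also have "\<dots> = (\<Sum>l<m. 2 * delta_vec A B $ l)"
      by (rule sum_distrib_left)
    also have "\<dots> = (\<Sum>l<j. if l < k then 2 * delta_vec A B $ l else 0)"
      unfolding m_def by (intro sum.mono_neutral_cong_left) auto
    finally show "(\<Sum>l<j. t l) \<le> (\<Sum>l<j. if l < k then 2 * delta_vec A B $ l else 0)" .
  qed (use singular_values_nonneg[OF X] singular_values_antimono[OF X] in \<open>auto simp: \<sigma>_def\<close>)
  also have "\<dots> = (\<Sum>i<k. 2 * (delta_vec A B $ i * singular_values X $ i))"
    using k by (intro sum.mono_neutral_cong_right) (auto simp: \<sigma>_def)
  finally show ?thesis .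
qed

section \<open>Weak majorization\<close>

lemma sum_mset_le_sum_list_take:
  fixes zs :: "real list"
  assumes "sorted_wrt (\<ge>) zs" "N \<subseteq># mset zs"
  shows "\<Sum>\<^sub># N \<le> sum_list (take (size N) zs)"
  using assms
proof (induction zs arbitrary: N)
  case (Cons z zs)
  show ?case
  proof (cases "z \<in># N")
    case True
    then obtain M where N: "N = add_mset z M"
      by (metis multi_member_split)
    then have "M \<subseteq># mset zs"
      using Cons.prems(2) by simp
    then have "\<Sum>\<^sub># M \<le> sum_list (take (size M) zs)"
      using Cons.IH Cons.prems(1) by simp
    then show ?thesis by (simp add: N)
  next
    case False
    have N_zs: "N \<subseteq># mset zs"
    proof (rule mset_subset_eqI)
      fix a
      show "count N a \<le> count (mset zs) a"
        using mset_subset_eq_count[OF Cons.prems(2), of a] False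
        by (cases "a = z") (simp_all add: not_in_iff)
    qed
    show ?thesis
    proof (cases N)
      case empty
      then show ?thesis by simp
    next
      case (add x M)
      have "x \<in> set zs"
        using mset_subset_eqD[OF N_zs, of x] by (simp add: add)
      then have "x \<le> z"
        using Cons.prems(1) by simp
      moreover have "M \<subseteq># mset zs"
        by (rule subset_mset.order_trans[OF _ N_zs]) (simp add: add)
      then have "\<Sum>\<^sub># M \<le> sum_list (take (size M) zs)"
        using Cons.IH Cons.prems(1) by simp
      ultimately show ?thesis by (simp add: add)
    qed
  qed
qed simp

lemma sum_le_sum_decreasing_rearrangement:
  assumes k: "k \<le> dim_vec x"
  shows "(\<Sum>i<k. x $ i) \<le> (\<Sum>i<k. decreasing_rearrangement x $ i)"
proof -
  let ?xs = "list_of_vec x"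
  let ?zs = "rev (sort ?xs)"
  have take_sum: "(\<Sum>i<k. l ! i) = sum_list (take k l)" if "k \<le> length l" for l :: "real list"
    using that by (simp add: sum_list_sum_nth lessThan_atLeast0)
  have "(\<Sum>i<k. x $ i) = sum_list (take k ?xs)"
    using k by (simp add: take_sum[symmetric] list_of_vec_index)
  also have "\<dots> = \<Sum>\<^sub># (mset (take k ?xs))"
    by (simp add: sum_mset_sum_list)
  also have "\<dots> \<le> sum_list (take (size (mset (take k ?xs))) ?zs)"
  proof (rule sum_mset_le_sum_list_take)
    show "sorted_wrt (\<ge>) ?zs" by (simp add: sorted_wrt_rev)
    have "mset (take k ?xs) \<subseteq># mset (take k ?xs @ drop k ?xs)"
      unfolding mset_append by simp
    then show "mset (take k ?xs) \<subseteq># mset ?zs" by simp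
  qed
  also have "\<dots> = (\<Sum>i<k. decreasing_rearrangement x $ i)"
    using k by (simp add: decreasing_rearrangement_def vec_of_list_index take_sum)
  finally show ?thesis .
qed

lemma decreasing_rearrangement_singular_values:
  "decreasing_rearrangement (singular_values X) = singular_values X"
proof -
  have "sort (rev (sorted_list_of_multiset M)) = sorted_list_of_multiset M" for M :: "real multiset"
    by (rule properties_for_sort) auto
  then show ?thesis
    by (simp add: decreasing_rearrangement_def singular_values_def list_vec)
qed

theorem mainTheorem10:
  fixes n :: nat and A B X :: "complex mat"
  assumes "A \<in> carrier_mat n n" and "B \<in> carrier_mat n n" and "X \<in> carrier_mat n n"
  shows "singular_values (A * X - X * B) \<prec>\<^sub>w 2 \<cdot>\<^sub>v (delta_vec A B \<odot>\<^sub>v singular_values X)"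
proof -
  let ?Y = "A * X - X * B" and ?y = "2 \<cdot>\<^sub>v (delta_vec A B \<odot>\<^sub>v singular_values X)"
  have "?Y \<in> carrier_mat n n"
    by (intro minus_carrier_mat square_mult_carrier assms)
  then have dim: "dim_vec (singular_values ?Y) = n" by (rule dim_singular_values)
  have dim_y: "dim_vec ?y = n" using assms by (simp add: entrywise_prod_def delta_vec_def)
  have "(\<Sum>i<k. decreasing_rearrangement (singular_values ?Y) $ i)
      \<le> (\<Sum>i<k. decreasing_rearrangement ?y $ i)" if k: "k \<le> n" for k
  proof -
    have "(\<Sum>i<k. decreasing_rearrangement (singular_values ?Y) $ i) = ky_fan_norm k ?Y"
      by (simp add: decreasing_rearrangement_singular_values ky_fan_norm_def)
    also have "\<dots> \<le> (\<Sum>i<k. 2 * (delta_vec A B $ i * singular_values X $ i))"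
      by (rule ky_fan_norm_sylvester_le[OF assms k])
    also have "\<dots> = (\<Sum>i<k. ?y $ i)"
      using k assms(1) by (intro sum.cong) (auto simp: entrywise_prod_def delta_vec_def)
    also have "\<dots> \<le> (\<Sum>i<k. decreasing_rearrangement ?y $ i)"
      using k dim_y by (intro sum_le_sum_decreasing_rearrangement) simp
    finally show ?thesis .
  qed
  then show ?thesis
    unfolding weakly_majorized_def using dim dim_y by simp
qed

end
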